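(* Let $d$ be a positive integer, let $G$ be a graph and let $u,v\in V(G)$ be a pair of vertices. If $\{u,v\}$ is $d$-stress-linked in $G$, then the set of $\mathcal{R}_d$-bridges is the same in $G$ and $G+uv$.
   Context: Graphs are finite and simple, with a nonempty edge set; a pair of vertices consists of two distinct vertices. $G+uv$ is $G$ with the edge $uv$ added ($G+uv=G$ if $uv\in E(G)$); $G-e$ is $G$ with the edge $e$ deleted. Let $G=(V,E)$. A realization (framework) of $G$ in $\mathbb{C}^d$ is a pair $(G,p)$ with $p:V\to\mathbb{C}^d$. It is generic if the $d|V|$ coordinates of $p$ do not satisfy any nonzero polynomial with rational coefficients. Put $m_{uv}(p)=\sum_{i=1}^d(p(u)_i-p(v)_i)^2$ and $m_{d,G}(p)=(m_{uv}(p))_{uv\in E}\in\mathbb{C}^E$. The generic rigidity matroid $\mathcal{R}_d(G)$ is the matroid on $E$ given by the rows of the Jacobian matrix of $m_{d,G}$ at any generic configuration $p$ (the result does not depend on $p$); $r_d(G)$ is its rank. An edge $e$ is an $\mathcal{R}_d$-bridge in $G$ if $r_d(G)=r_d(G-e)+1$. A pair $\{u,v\}$ is $\mathcal{R}_d$-linked in $G$ if $r_d(G+uv)=r_d(G)$. A stress of $(G,p)$ is a vector $\omega\in\mathbb{C}^E$ with $\sum_{u:uv\in E}\omega_{uv}(p(u)-p(v))=0$ for every $v\in V$; $S(G,p)$ is the linear space of stresses. Set $K_1(G,p)=\{q\in\mathbb{C}^V: S(G,p)\subseteq S(G,q)\}$, where $q$ is viewed as a one-dimensional realization; this is a linear space.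 Its dimension is the same for every generic $(G,p)$ in $\mathbb{C}^d$; this number is denoted $k_{d,G}$. A pair $\{u,v\}$ is $d$-stress-linked in $G$ if $\{u,v\}$ is $\mathcal{R}_d$-linked in $G$ and $k_{d,G+uv}=k_{d,G}$. *)

theory Defs
  imports "HOL-Analysis.Analysis" "HOL-Library.Poly_Mapping"
begin

text \<open>
  A graph has the finite type \<open>'v\<close> as its vertex set and is given by its set of edges,
  each edge being a two-element set of vertices.  Then \<open>G + uv\<close> is \<open>insert {u, v} E\<close>
  and \<open>G - e\<close> is \<open>E - {e}\<close>.  The dimension \<open>d\<close> is \<open>CARD('d)\<close>.
\<close>

definition graph :: "'v::finite set set \<Rightarrow> bool" where
  "graph E \<longleftrightarrow> E \<noteq> {} \<and> (\<forall>e\<in>E. card e = 2)"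

type_synonym ('v, 'd) realization = "'v \<Rightarrow> complex ^ 'd"

text \<open>
  A polynomial over the rationals in variables indexed by \<open>'x\<close> is a finitely supported
  function from monomials to \<open>rat\<close>; a monomial is a finitely supported exponent function.
\<close>

definition eval_poly :: "(('x \<Rightarrow>\<^sub>0 nat) \<Rightarrow>\<^sub>0 rat) \<Rightarrow> ('x \<Rightarrow> complex) \<Rightarrow> complex" where
  "eval_poly P x = (\<Sum>m\<in>Poly_Mapping.keys P. of_rat (Poly_Mapping.lookup P m) *
     (\<Prod>c\<in>Poly_Mapping.keys m. x c ^ Poly_Mapping.lookup m c))"

definition generic :: "('v::finite, 'd::finite) realization \<Rightarrow> bool" where
  "generic p \<longleftrightarrow>
     (\<forall>P :: (('v \<times> 'd) \<Rightarrow>\<^sub>0 nat) \<Rightarrow>\<^sub>0 rat. P \<noteq> 0 \<longrightarrow> eval_poly P (\<lambda>(v, i). p v $ i) \<noteq> 0)"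

text \<open>
  Only used for quantities that take the same value at every generic realization, so the
  choice is immaterial.
\<close>

definition some_generic :: "('v::finite, 'd::finite) realization" where
  "some_generic = (SOME p. generic p)"

definition sq_len :: "'v \<Rightarrow> 'v \<Rightarrow> ('v, 'd::finite) realization \<Rightarrow> complex" where
  "sq_len u v p = (\<Sum>i\<in>UNIV. (p u $ i - p v $ i)\<^sup>2)"

definition set_coord :: "('v, 'd::finite) realization \<Rightarrow> 'v \<Rightarrow> 'd \<Rightarrow> complex \<Rightarrow> ('v, 'd) realization"
  where "set_coord p w i z = p(w := (\<chi> j. if j = i then z else p w $ j))"

text \<open>
  The row of the Jacobian of the measurement map indexed by the edge \<open>{u, v}\<close>, that is, the
  vector of all partial derivatives of \<open>sq_len u v\<close> at \<open>p\<close>.  It is symmetric in \<open>u\<close> and \<open>v\<close>.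
\<close>

definition jacobian_row ::
    "('v::finite, 'd::finite) realization \<Rightarrow> 'v \<Rightarrow> 'v \<Rightarrow> complex ^ ('v \<times> 'd)" where
  "jacobian_row p u v =
     (\<chi> c. case c of (w, i) \<Rightarrow>
       deriv (\<lambda>z. sq_len u v (set_coord p w i z)) (p w $ i))"

lemma jacobian_row_nth:
  "jacobian_row p u v $ (w, i) =
     (if u = v then 0 else if w = u then 2 * (p u $ i - p v $ i)
      else if w = v then 2 * (p v $ i - p u $ i) else 0)"
proof -
  let ?z = "p w $ i"
  have D: "((\<lambda>z. sq_len u v (set_coord p w i z)) has_field_derivative
     (\<Sum>j\<in>UNIV. 2 * (p u $ j - p v $ j) * ((if w = u \<and> j = i then 1 else 0) - (if w = v \<and> j = i then 1 else 0)))) (at ?z)"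
    unfolding sq_len_def
    apply (rule DERIV_sum)
    subgoal for j
      apply (cases "w = u"; cases "w = v"; cases "j = i")
      by (auto simp: set_coord_def intro!: derivative_eq_intros)
    done
  have "jacobian_row p u v $ (w,i) = (\<Sum>j\<in>UNIV. 2 * (p u $ j - p v $ j) * ((if w = u \<and> j = i then 1 else 0) - (if w = v \<and> j = i then 1 else 0)))"
    unfolding jacobian_row_def using DERIV_imp_deriv[OF D] by simp
  also have "... = (\<Sum>j\<in>UNIV. if j = i then 2 * (p u $ i - p v $ i) * ((if w = u then 1 else 0) - (if w = v then 1 else 0)) else 0)"
    by (rule sum.cong) auto
  finally show ?thesis by auto
qed

definition jacobian_rank :: "'v::finite set set \<Rightarrow> ('v, 'd::finite) realization \<Rightarrow> nat" where
  "jacobian_rank E p = vec.dim {jacobian_row p u v | u v. {u, v} \<in> E}"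

text \<open>The type argument carries the dimension \<open>d\<close>.\<close>

definition rigidity_rank :: "'d::finite itself \<Rightarrow> 'v::finite set set \<Rightarrow> nat" where
  "rigidity_rank _ E = jacobian_rank E (some_generic :: ('v, 'd) realization)"

definition bridge :: "'d::finite itself \<Rightarrow> 'v::finite set set \<Rightarrow> 'v set \<Rightarrow> bool" where
  "bridge d E e \<longleftrightarrow> e \<in> E \<and> rigidity_rank d E = rigidity_rank d (E - {e}) + 1"

definition linked :: "'d::finite itself \<Rightarrow> 'v::finite set set \<Rightarrow> 'v \<Rightarrow> 'v \<Rightarrow> bool" where
  "linked d E u v \<longleftrightarrow> rigidity_rank d (insert {u, v} E) = rigidity_rank d E"

text \<open>
  Elements of \<open>\<complex>\<^sup>E\<close> are vectors indexed by all vertex sets that vanish outside \<open>E\<close>.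
\<close>

definition stresses ::
    "'v::finite set set \<Rightarrow> ('v, 'd::finite) realization \<Rightarrow> (complex ^ ('v set)) set" where
  "stresses E p = {\<omega>. (\<forall>e. e \<notin> E \<longrightarrow> \<omega> $ e = 0) \<and>
     (\<forall>v. (\<Sum>u | {u, v} \<in> E. \<omega> $ {u, v} *s (p u - p v)) = 0)}"

definition K1 :: "'v::finite set set \<Rightarrow> ('v, 'd::finite) realization \<Rightarrow> (complex ^ 'v) set" where
  "K1 E p = {q. stresses E p \<subseteq> stresses E (\<lambda>v. vec (q $ v) :: complex ^ 1)}"

definition k_dim :: "'d::finite itself \<Rightarrow> 'v::finite set set \<Rightarrow> nat" where
  "k_dim _ E = vec.dim (K1 E (some_generic :: ('v, 'd) realization))"

definition stress_linked :: "'d::finite itself \<Rightarrow> 'v::finite set set \<Rightarrow> 'v \<Rightarrow> 'v \<Rightarrow> bool" where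
  "stress_linked d E u v \<longleftrightarrow> linked d E u v \<and> k_dim d (insert {u, v} E) = k_dim d E"

end

theory Submission
  imports Defs
begin

text \<open>
  Fix a generic realization \<open>p\<close> and assume that \<open>uv\<close> is not an edge.  A bridge is an edge whose row
  of the rigidity matrix is not in the span of the other rows, equivalently an edge at which every
  stress vanishes.  Since \<open>uv\<close> is linked, it is no bridge of \<open>G + uv\<close>, and every bridge
  \<open>e \<noteq> uv\<close> of \<open>G + uv\<close> is a bridge of \<open>G\<close>.  The content of the theorem is the converse, where the
  second half of the hypothesis enters in the form \<open>K\<^sub>1(G + uv, p) = K\<^sub>1(G, p)\<close>: one inclusion always
  holds, and the dimensions agree.

  Let \<open>e\<close> be a bridge of \<open>G\<close>, and suppose that some stress \<open>\<omega>\<close> of \<open>(G + uv, p)\<close> has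
  \<open>\<omega>\<^sub>e \<noteq> 0\<close>.  Write \<open>b\<^sub>f(p, \<mu>)\<close> for the scalar product of the difference vectors of \<open>p\<close> and \<open>\<mu>\<close> along
  an edge \<open>f\<close>.  As \<open>e\<close> is a bridge, \<open>G - e\<close> has an infinitesimal flex \<open>\<mu>\<close> at \<open>p\<close> with
  \<open>b\<^sub>e(p, \<mu>) \<noteq> 0\<close>.  Two facts lead to a contradiction.

  The first is that every stress of \<open>(G - e, p)\<close> is also a stress of \<open>\<mu>\<close>
  (\<open>generic_stress_of_flex\<close>).  The rank of the rigidity matrix is maximal at a generic point, so along
  every line \<open>p + t \<pi>\<close> it cannot exceed its value at \<open>t = 0\<close>.  Therefore, if the rows at \<open>p\<close> satisfy a
  linear relation, the same combination of the rows at \<open>\<pi>\<close> lies in the row space at \<open>p\<close>, which \<open>\<mu>\<close>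
  annihilates; and \<open>b\<^sub>f(\<pi>, \<mu>)\<close> is symmetric, so that this, for all \<open>\<pi>\<close>, says that the relation also
  holds at \<open>\<mu>\<close>.  All stresses of \<open>(G, p)\<close> vanish at \<open>e\<close> and are thus stresses of \<open>(G - e, p)\<close>.  Hence the
  coordinates of \<open>\<mu>\<close> lie in \<open>K\<^sub>1(G, p) = K\<^sub>1(G + uv, p)\<close>, and \<open>\<omega>\<close> is a stress of \<open>\<mu>\<close>.

  The second is projective invariance (\<open>projectively_weighted_stress\<close>).  If \<open>\<alpha>\<close> is a linear
  functional, then the projective maps that send a point \<open>z\<close> to \<open>z / (1 + t \<alpha>(z))\<close> carry \<open>\<omega>\<close> to
  stresses whose derivative at \<open>t = 0\<close> has the entries \<open>\<omega>\<^sub>x\<^sub>y (\<alpha>(p\<^sub>x) + \<alpha>(p\<^sub>y))\<close>.  For a realization \<open>\<mu>\<close> with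
  stress \<open>\<omega>\<close> this shows that these weighted coefficients still annihilate the numbers \<open>b\<^sub>f(p, \<mu>)\<close>.

  Both \<open>\<omega>\<close> and its weighted form thus annihilate the numbers \<open>b\<^sub>f(p, \<mu>)\<close>, of which only those at \<open>e\<close>
  and \<open>uv\<close> are nonzero.  Eliminating the term at \<open>uv\<close> leaves
  \<open>\<omega>\<^sub>e b\<^sub>e(p, \<mu>) (\<alpha>(p\<^sub>x) + \<alpha>(p\<^sub>y) - \<alpha>(p\<^sub>u) - \<alpha>(p\<^sub>v)) = 0\<close> for \<open>e = xy\<close>, which is
  impossible for generic \<open>p\<close> when \<open>\<alpha>\<close> is a coordinate function.
\<close>

section \<open>Determinants and spans\<close>

lemma det_nonzero_iff_rows_independent:
  fixes \<beta> :: "'n::finite \<Rightarrow> 'a::field ^ 'n"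
  shows "det (\<chi> n. \<beta> n) \<noteq> 0 \<longleftrightarrow> inj \<beta> \<and> vec.independent (range \<beta>)"
proof -
  have row: "row n (\<chi> n. \<beta> n) = \<beta> n" for n
    by (simp add: row_def vec_eq_iff)
  have "det (\<chi> n. \<beta> n) \<noteq> 0 \<longleftrightarrow> (\<forall>c. (\<Sum>n\<in>UNIV. c n *s \<beta> n) = 0 \<longrightarrow> (\<forall>n. c n = 0))"
    unfolding invertible_det_nz[symmetric] invertible_right_inverse
      matrix_right_invertible_independent_rows row ..
  also have "\<dots> \<longleftrightarrow> inj \<beta> \<and> vec.independent (range \<beta>)"
  proof (intro iffI conjI)
    assume *: "\<forall>c. (\<Sum>n\<in>UNIV. c n *s \<beta> n) = 0 \<longrightarrow> (\<forall>n. c n = 0)"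
    show inj: "inj \<beta>"
    proof (rule injI, rule ccontr)
      fix m n assume eq: "\<beta> m = \<beta> n" and ne: "m \<noteq> n"
      define c :: "'n \<Rightarrow> 'a" where "c k = (if k = m then 1 else if k = n then -1 else 0)" for k
      have "(\<Sum>k\<in>UNIV. c k *s \<beta> k) = (\<Sum>k\<in>{m, n}. c k *s \<beta> k)"
        by (rule sum.mono_neutral_right) (auto simp: c_def)
      also have "\<dots> = 0"
        using ne eq by (simp add: c_def vec_eq_iff)
      finally have "c m = 0" using * by blast
      then show False by (simp add: c_def)
    qed
    show "vec.independent (range \<beta>)"
    proof (rule vec.independent_if_scalars_zero)
      fix f x assume 0: "(\<Sum>x\<in>range \<beta>. f x *s x) = 0" and "x \<in> range \<beta>"
      then show "f x = 0"
        using *[rule_format, of "f \<circ> \<beta>"] by (auto simp: sum.reindex[OF inj] o_def)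
    qed simp
  next
    assume *: "inj \<beta> \<and> vec.independent (range \<beta>)"
    show "\<forall>c. (\<Sum>n\<in>UNIV. c n *s \<beta> n) = 0 \<longrightarrow> (\<forall>n. c n = 0)"
    proof (intro allI impI)
      fix c n assume 0: "(\<Sum>n\<in>UNIV. c n *s \<beta> n) = 0"
      have "(\<Sum>x\<in>range \<beta>. c (inv \<beta> x) *s x) = 0"
        using * 0 by (simp add: sum.reindex)
      then have "c (inv \<beta> (\<beta> n)) = 0"
        using vec.independentD[of "range \<beta>" "range \<beta>" "\<lambda>x. c (inv \<beta> x)" "\<beta> n"] * by auto
      then show "c n = 0" using * by simp
    qed
  qed
  finally show ?thesis .
qed

text \<open>
  Completing an independent set by standard unit vectors turns statements on rank into statements on
  one determinant.  The added rows are constant with entries 0 and 1, so when the rows in \<open>S\<close> vary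
  polynomially with rational coefficients, so does the determinant.
\<close>

lemma basis_enumeration_extending:
  fixes S :: "('a::field ^ 'n::finite) set"
  assumes "vec.independent S"
  obtains \<beta> :: "'n \<Rightarrow> 'a ^ 'n"
  where "S \<subseteq> range \<beta>" "range \<beta> \<subseteq> S \<union> cart_basis" "det (\<chi> n. \<beta> n) \<noteq> 0"
proof -
  obtain B where B: "S \<subseteq> B" "B \<subseteq> S \<union> cart_basis" "vec.independent B" "S \<union> cart_basis \<subseteq> vec.span B"
    using vec.maximal_independent_subset_extend[of S "S \<union> cart_basis"] assms by blast
  have "vec.span (cart_basis :: ('a ^ 'n) set) \<subseteq> vec.span B"
    using B(4) by (intro vec.span_minimal) auto
  then have "vec.span B = UNIV" by (simp add: top.extremum_unique)
  then have "card B = CARD('n)"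
    using vec.dim_eq_card[of B UNIV] B(3) by (simp add: card_cart_basis)
  moreover have "finite B" using B(3) vec.finiteI_independent by blast
  ultimately obtain \<beta> where "bij_betw \<beta> (UNIV :: 'n set) B"
    using finite_same_card_bij[of "UNIV :: 'n set" B] by auto
  then have "inj \<beta>" "range \<beta> = B" by (auto simp: bij_betw_def)
  with B show ?thesis
    by (intro that[of \<beta>]) (auto simp: det_nonzero_iff_rows_independent)
qed

text \<open>
  The way back from the determinant to the rank, after the vectors of \<open>S\<close> were moved by \<open>\<phi>\<close> and the
  completing vectors were left in place.
\<close>

lemma card_le_dim_of_perturbed_basis:
  fixes \<beta> :: "'n::finite \<Rightarrow> 'a::field ^ 'n"
  assumes det: "det (\<chi> n. if \<beta> n \<in> S then \<phi> (\<beta> n) else \<beta> n) \<noteq> 0"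
    and S: "S \<subseteq> range \<beta>" and span: "\<phi> ` S \<subseteq> vec.span T"
  shows "card S \<le> vec.dim T"
proof -
  define \<gamma> where "\<gamma> n = (if \<beta> n \<in> S then \<phi> (\<beta> n) else \<beta> n)" for n
  have \<gamma>: "inj \<gamma>" "vec.independent (range \<gamma>)"
    using det det_nonzero_iff_rows_independent[of \<gamma>] by (auto simp: \<gamma>_def)
  have sub: "\<phi> ` S \<subseteq> range \<gamma>"
  proof
    fix y assume "y \<in> \<phi> ` S"
    then obtain n where "\<beta> n \<in> S" "y = \<phi> (\<beta> n)" using S by blast
    then show "y \<in> range \<gamma>" by (metis \<gamma>_def rangeI)
  qed
  have "inj_on \<phi> S"
  proof (rule inj_onI)
    fix x y assume "x \<in> S" "y \<in> S" "\<phi> x = \<phi> y"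
    moreover obtain m n where "x = \<beta> m" "y = \<beta> n" using S calculation by blast
    ultimately have "\<gamma> m = \<gamma> n" by (simp add: \<gamma>_def)
    then show "x = y" using \<gamma>(1) \<open>x = \<beta> m\<close> \<open>y = \<beta> n\<close> by (simp add: inj_eq)
  qed
  then have "card S = card (\<phi> ` S)" by (simp add: card_image)
  also have "\<dots> \<le> vec.dim (vec.span T)"
    using span vec.independent_mono[OF \<gamma>(2) sub] by (rule vec.independent_card_le_dim)
  finally show ?thesis by simp
qed

text \<open>
  Complete \<open>x\<close> and a basis of the span of \<open>S\<close> to a square matrix; the wanted vector is the column of the inverse
  matrix that belongs to \<open>x\<close>.
\<close>

lemma separating_vector:
  fixes S :: "('a::field ^ 'n::finite) set"
  assumes "x \<notin> vec.span S"
  obtains \<mu> :: "'a ^ 'n" where "\<And>s. s \<in> S \<Longrightarrow> (\<Sum>i\<in>UNIV. s $ i * \<mu> $ i) = 0" "(\<Sum>i\<in>UNIV. x $ i * \<mu> $ i) = 1"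
proof -
  obtain B where B: "B \<subseteq> S" "vec.independent B" "S \<subseteq> vec.span B"
    by (rule vec.basis_exists[of S])
  have xB: "x \<notin> vec.span B" using assms B(1) vec.span_mono by blast
  then have "vec.independent (insert x B)"
    using B(2) by (simp add: vec.independent_insert vec.span_base)
  then obtain \<beta> where \<beta>: "insert x B \<subseteq> range \<beta>" "det (\<chi> n. \<beta> n) \<noteq> 0"
    by (rule basis_enumeration_extending)
  define M where "M = (\<chi> n. \<beta> n)"
  obtain N where N: "M ** N = mat 1"
    using \<beta>(2) unfolding M_def[symmetric] invertible_det_nz[symmetric] invertible_def by blast
  obtain k where k: "\<beta> k = x" using \<beta>(1) by auto
  define \<mu> where "\<mu> = N *v axis k 1"
  have "M *v \<mu> = axis k 1"
    using N by (simp add: \<mu>_def matrix_vector_mul_assoc)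
  from arg_cong[OF this, of "\<lambda>v. v $ n" for n]
  have \<mu>: "(\<Sum>i\<in>UNIV. \<beta> n $ i * \<mu> $ i) = axis k 1 $ n" for n
    by (simp add: M_def matrix_vector_mult_def)
  show ?thesis
  proof (rule that)
    show "(\<Sum>i\<in>UNIV. x $ i * \<mu> $ i) = 1" using \<mu>[of k] k by (simp add: axis_def)
    have "vec.subspace {s. (\<Sum>i\<in>UNIV. s $ i * \<mu> $ i) = 0}"
      by (auto simp: vec.subspace_def sum.distrib distrib_right mult.assoc simp flip: sum_distrib_left)
    moreover have "B \<subseteq> {s. (\<Sum>i\<in>UNIV. s $ i * \<mu> $ i) = 0}"
    proof
      fix b assume "b \<in> B"
      with \<beta>(1) obtain n where n: "b = \<beta> n" by auto
      with \<open>b \<in> B\<close> k xB have "n \<noteq> k" using vec.span_base by auto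
      with \<mu>[of n] n show "b \<in> {s. (\<Sum>i\<in>UNIV. s $ i * \<mu> $ i) = 0}" by (simp add: axis_def)
    qed
    ultimately have "vec.span B \<subseteq> {s. (\<Sum>i\<in>UNIV. s $ i * \<mu> $ i) = 0}"
      by (intro vec.span_minimal)
    then show "(\<Sum>i\<in>UNIV. s $ i * \<mu> $ i) = 0" if "s \<in> S" for s
      using B(3) that by blast
  qed
qed

text \<open>
  Infinitesimal form of the constant rank theorem.  If the derivative of the relation were
  outside the span of the vectors \<open>A e\<close>, choose some \<open>e\<close> for which the \<open>A e\<close> form a basis of this span.
  By continuity of the determinant, the corresponding \<open>A e + t B e\<close> and the derivative are independent
  for small \<open>t\<close>.  But \<open>t\<close> times the derivative lies in the span of all \<open>A e + t B e\<close>, so for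
  \<open>t \<noteq> 0\<close> this span has a larger dimension than at \<open>t = 0\<close>.
\<close>

lemma derivative_of_relation_in_span:
  fixes A B :: "'e \<Rightarrow> complex ^ 'n::finite"
  assumes fin: "finite I"
    and max: "\<And>t. vec.dim ((\<lambda>e. A e + t *s B e) ` I) \<le> vec.dim (A ` I)"
    and rel: "(\<Sum>e\<in>I. \<omega> e *s A e) = 0"
  shows "(\<Sum>e\<in>I. \<omega> e *s B e) \<in> vec.span (A ` I)"
proof (rule ccontr)
  define z where "z = (\<Sum>e\<in>I. \<omega> e *s B e)"
  assume "(\<Sum>e\<in>I. \<omega> e *s B e) \<notin> vec.span (A ` I)"
  then have z: "z \<notin> vec.span (A ` I)" by (simp add: z_def)
  obtain C where C: "C \<subseteq> A ` I" "vec.independent C" "A ` I \<subseteq> vec.span C" "card C = vec.dim (A ` I)"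
    by (rule vec.basis_exists[of "A ` I"])
  from C(1) have "\<forall>c\<in>C. \<exists>e\<in>I. A e = c" by auto
  then obtain g where g: "g c \<in> I" "A (g c) = c" if "c \<in> C" for c by metis
  have zC: "z \<notin> vec.span C" using z C(1) vec.span_mono by blast
  then have "z \<notin> C" using vec.span_base by blast
  define S where "S = insert z C"
  have "vec.independent S"
    using C(2) zC by (simp add: S_def vec.independent_insert vec.span_base)
  then obtain \<beta> where \<beta>: "S \<subseteq> range \<beta>" "det (\<chi> n. \<beta> n) \<noteq> 0"
    by (rule basis_enumeration_extending)
  \<comment> \<open>The derivative \<open>z\<close> itself stays fixed: for \<open>t \<noteq> 0\<close> it lies in the span of the moved vectors.\<close>
  define \<phi> where "\<phi> t s = (if s = z then z else s + t *s B (g s))" for t s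
  define M where "M t = det (\<chi> n. if \<beta> n \<in> S then \<phi> t (\<beta> n) else \<beta> n)" for t
  have "isCont (\<lambda>t. (if \<beta> n \<in> S then \<phi> t (\<beta> n) else \<beta> n) $ k) 0" for n k
    by (cases "\<beta> n \<in> S"; cases "\<beta> n = z") (auto simp: \<phi>_def)
  then have "isCont M 0"
    unfolding M_def det_def vec_lambda_beta
    by (intro continuous_sum continuous_mult continuous_prod continuous_const)
  moreover have "M 0 \<noteq> 0"
  proof -
    have "(if \<beta> n \<in> S then \<phi> 0 (\<beta> n) else \<beta> n) = \<beta> n" for n
      by (simp add: \<phi>_def)
    then show ?thesis using \<beta>(2) by (simp add: M_def)
  qed
  ultimately have "eventually (\<lambda>t. M t \<noteq> 0) (at 0)"
    by (auto simp: isCont_def intro: tendsto_imp_eventually_ne)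
  then have "eventually (\<lambda>t. t \<noteq> 0 \<and> M t \<noteq> 0) (at 0)"
    by (intro eventually_conj) (auto simp: eventually_at_filter)
  then obtain t where t: "t \<noteq> 0" "M t \<noteq> 0"
    using eventually_happens[of _ "at (0::complex)"] by auto
  let ?T = "(\<lambda>e. A e + t *s B e) ` I"
  have "(\<Sum>e\<in>I. \<omega> e *s (A e + t *s B e)) \<in> vec.span ?T"
    by (intro vec.span_sum vec.span_scale vec.span_base imageI)
  also have "(\<Sum>e\<in>I. \<omega> e *s (A e + t *s B e)) = (\<Sum>e\<in>I. \<omega> e *s A e) + t *s z"
    by (simp add: z_def vec_eq_iff sum.distrib sum_distrib_left algebra_simps)
  finally have "t *s z \<in> vec.span ?T"
    unfolding rel by simp
  then have "(1 / t) *s (t *s z) \<in> vec.span ?T" by (rule vec.span_scale)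
  moreover have "(1 / t) *s (t *s z) = z" using t(1) by (simp add: vector_smult_assoc)
  ultimately have zT: "z \<in> vec.span ?T" by (simp only:)
  have "\<phi> t ` S \<subseteq> vec.span ?T"
  proof (rule image_subsetI)
    fix s assume "s \<in> S"
    show "\<phi> t s \<in> vec.span ?T"
    proof (cases "s = z")
      case False
      with \<open>s \<in> S\<close> have "s \<in> C" by (simp add: S_def)
      then have "s + t *s B (g s) \<in> ?T" using g[of s] by (intro image_eqI[of _ _ "g s"]) auto
      then show ?thesis using False by (simp add: \<phi>_def vec.span_base)
    qed (simp add: \<phi>_def zT)
  qed
  then have "card S \<le> vec.dim ?T"
    using t(2) \<beta>(1) unfolding M_def by (intro card_le_dim_of_perturbed_basis[of \<beta> S "\<phi> t"])
  also have "\<dots> \<le> card C" using max C(4) by simp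
  finally show False
    using \<open>z \<notin> C\<close> vec.finiteI_independent[OF C(2)] by (simp add: S_def)
qed

lemma span_image_coefficients:
  fixes f :: "'e \<Rightarrow> complex ^ 'n::finite"
  assumes "x \<in> vec.span (f ` F)" "finite F"
  obtains c where "x = (\<Sum>e\<in>F. c e *s f e)"
proof -
  have "vec.subspace (range (\<lambda>c. \<Sum>e\<in>F. c e *s f e))"
    unfolding vec.subspace_def
  proof (intro conjI ballI allI)
    show "0 \<in> range (\<lambda>c. \<Sum>e\<in>F. c e *s f e)"
      by (rule range_eqI[of _ _ "\<lambda>_. 0"]) simp
    show "a + b \<in> range (\<lambda>c. \<Sum>e\<in>F. c e *s f e)"
      if ab: "a \<in> range (\<lambda>c. \<Sum>e\<in>F. c e *s f e)" "b \<in> range (\<lambda>c. \<Sum>e\<in>F. c e *s f e)" for a b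
    proof -
      obtain c d where "a = (\<Sum>e\<in>F. c e *s f e)" "b = (\<Sum>e\<in>F. d e *s f e)" using ab by auto
      then show ?thesis
        by (intro range_eqI[of _ _ "\<lambda>e. c e + d e"]) (simp add: vec.scale_left_distrib sum.distrib)
    qed
    show "t *s a \<in> range (\<lambda>c. \<Sum>e\<in>F. c e *s f e)"
      if a: "a \<in> range (\<lambda>c. \<Sum>e\<in>F. c e *s f e)" for t a
    proof -
      obtain c where "a = (\<Sum>e\<in>F. c e *s f e)" using a by auto
      then show ?thesis
        by (intro range_eqI[of _ _ "\<lambda>e. t * c e"]) (simp add: vec.scale_sum_right vec.scale_scale)
    qed
  qed
  moreover have "f ` F \<subseteq> range (\<lambda>c. \<Sum>e\<in>F. c e *s f e)"
  proof (rule image_subsetI)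
    fix e assume "e \<in> F"
    have "(\<Sum>e'\<in>F. (if e' = e then 1 else 0) *s f e') = (\<Sum>e'\<in>F. if e' = e then f e else 0)"
      by (rule sum.cong) auto
    then show "f e \<in> range (\<lambda>c. \<Sum>e\<in>F. c e *s f e)"
      using \<open>e \<in> F\<close> assms(2) by (intro range_eqI[of _ _ "\<lambda>e'. if e' = e then 1 else 0"]) simp
  qed
  ultimately have "vec.span (f ` F) \<subseteq> range (\<lambda>c. \<Sum>e\<in>F. c e *s f e)" by (intro vec.span_minimal)
  then show ?thesis using assms(1) that by blast
qed

section \<open>Rational polynomials and generic realizations\<close>

definition monomial_value :: "('x::finite \<Rightarrow>\<^sub>0 nat) \<Rightarrow> ('x \<Rightarrow> complex) \<Rightarrow> complex" where
  "monomial_value m x = (\<Prod>c\<in>UNIV. x c ^ Poly_Mapping.lookup m c)"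

lemma eval_poly_eq_sum:
  assumes "finite A" "Poly_Mapping.keys P \<subseteq> A"
  shows "eval_poly P x = (\<Sum>m\<in>A. of_rat (Poly_Mapping.lookup P m) * monomial_value m x)"
proof -
  have "(\<Prod>c\<in>Poly_Mapping.keys m. x c ^ Poly_Mapping.lookup m c) = monomial_value m x" for m
    unfolding monomial_value_def
    by (rule prod.mono_neutral_left) (auto simp: in_keys_iff)
  then have "eval_poly P x = (\<Sum>m\<in>Poly_Mapping.keys P. of_rat (Poly_Mapping.lookup P m) * monomial_value m x)"
    by (simp add: eval_poly_def)
  also have "\<dots> = (\<Sum>m\<in>A. of_rat (Poly_Mapping.lookup P m) * monomial_value m x)"
    using assms by (intro sum.mono_neutral_left) (auto simp: in_keys_iff)
  finally show ?thesis .
qed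

text \<open>
  Describing polynomials by the functions they induce avoids computing with the coefficients of
  products and determinants.
\<close>

definition rational_polynomial_function :: "(('x::finite \<Rightarrow> complex) \<Rightarrow> complex) \<Rightarrow> bool" where
  "rational_polynomial_function f \<longleftrightarrow> (\<exists>P. \<forall>x. f x = eval_poly P x)"

lemma rational_polynomial_function_monomial:
  "rational_polynomial_function (\<lambda>x. of_rat a * monomial_value m x)"
  unfolding rational_polynomial_function_def
  by (intro exI[of _ "Poly_Mapping.single m a"] allI)
     (subst eval_poly_eq_sum[of "{m}"], auto)

lemma rational_polynomial_function_add:
  assumes "rational_polynomial_function f" "rational_polynomial_function g"
  shows "rational_polynomial_function (\<lambda>x. f x + g x)"
proof -
  obtain P Q where P: "\<And>x. f x = eval_poly P x" and Q: "\<And>x. g x = eval_poly Q x"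
    using assms by (auto simp: rational_polynomial_function_def)
  let ?A = "Poly_Mapping.keys P \<union> Poly_Mapping.keys Q"
  have "f x + g x = eval_poly (P + Q) x" for x
    using Poly_Mapping.keys_add[of P Q]
    by (simp add: P Q eval_poly_eq_sum[of ?A] lookup_add of_rat_add distrib_right sum.distrib)
  then show ?thesis by (auto simp: rational_polynomial_function_def)
qed

lemma rational_polynomial_function_const: "rational_polynomial_function (\<lambda>x. of_rat a)"
  using rational_polynomial_function_monomial[of a 0] by (simp add: monomial_value_def)

lemma rational_polynomial_function_coordinate: "rational_polynomial_function (\<lambda>x. x c)"
proof -
  have "monomial_value (Poly_Mapping.single c 1) x = x c" for x :: "'a \<Rightarrow> complex"
  proof -
    have "monomial_value (Poly_Mapping.single c 1) x = (\<Prod>b\<in>UNIV. if b = c then x b else 1)"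
      unfolding monomial_value_def by (rule prod.cong) (auto simp: lookup_single)
    then show ?thesis by simp
  qed
  then show ?thesis using rational_polynomial_function_monomial[of 1 "Poly_Mapping.single c 1"] by simp
qed

lemma rational_polynomial_function_sum:
  assumes "\<And>i. i \<in> I \<Longrightarrow> rational_polynomial_function (f i)"
  shows "rational_polynomial_function (\<lambda>x. \<Sum>i\<in>I. f i x)"
  using assms
proof (induction I rule: infinite_finite_induct)
  case (insert i I)
  then show ?case by (simp add: rational_polynomial_function_add)
qed (use rational_polynomial_function_const[of 0] in simp_all)

lemma rational_polynomial_function_mult:
  assumes "rational_polynomial_function f" "rational_polynomial_function g"
  shows "rational_polynomial_function (\<lambda>x. f x * g x)"
proof -
  obtain P Q where P: "\<And>x. f x = eval_poly P x" and Q: "\<And>x. g x = eval_poly Q x"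
    using assms by (auto simp: rational_polynomial_function_def)
  have "f x * g x = (\<Sum>m\<in>Poly_Mapping.keys P. \<Sum>n\<in>Poly_Mapping.keys Q.
      of_rat (Poly_Mapping.lookup P m * Poly_Mapping.lookup Q n) * monomial_value (m + n) x)" for x
    by (simp add: P Q eval_poly_eq_sum[OF _ order_refl] sum_product monomial_value_def lookup_add
        power_add prod.distrib of_rat_mult mult_ac)
  then show ?thesis
    by (simp add: rational_polynomial_function_sum rational_polynomial_function_monomial)
qed

lemma rational_polynomial_function_prod:
  assumes "\<And>i. i \<in> I \<Longrightarrow> rational_polynomial_function (f i)"
  shows "rational_polynomial_function (\<lambda>x. \<Prod>i\<in>I. f i x)"
  using assms
proof (induction I rule: infinite_finite_induct)
  case (insert i I)
  then show ?case by (simp add: rational_polynomial_function_mult)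
qed (use rational_polynomial_function_const[of 1] in simp_all)

lemma rational_polynomial_function_of_int: "rational_polynomial_function (\<lambda>x. of_int a)"
  using rational_polynomial_function_const[of "of_int a"] by simp

lemma rational_polynomial_function_diff:
  assumes "rational_polynomial_function f" "rational_polynomial_function g"
  shows "rational_polynomial_function (\<lambda>x. f x - g x)"
  using rational_polynomial_function_add[OF assms(1)
      rational_polynomial_function_mult[OF rational_polynomial_function_of_int[of "-1"] assms(2)]]
  by simp

lemma rational_polynomial_function_det:
  assumes "\<And>i j. rational_polynomial_function (\<lambda>x. M x $ i $ j)"
  shows "rational_polynomial_function (\<lambda>x. det (M x))"
  unfolding det_def
  by (intro rational_polynomial_function_sum rational_polynomial_function_mult
      rational_polynomial_function_prod rational_polynomial_function_of_int assms)

definition coordinates :: "('v, 'd::finite) realization \<Rightarrow> 'v \<times> 'd \<Rightarrow> complex" where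
  "coordinates p = (\<lambda>(v, i). p v $ i)"

text \<open>
  This is how genericity is used: a rational polynomial that is nonzero at some realization is a nonzero
  polynomial.
\<close>

lemma generic_nonzero:
  fixes p q :: "('v::finite, 'd::finite) realization"
  assumes "generic p" "rational_polynomial_function f" "f (coordinates q) \<noteq> 0"
  shows "f (coordinates p) \<noteq> 0"
proof -
  obtain P where P: "\<And>x. f x = eval_poly P x"
    using assms(2) by (auto simp: rational_polynomial_function_def)
  have "P \<noteq> 0" using assms(3) by (auto simp: P eval_poly_def)
  then show ?thesis using assms(1) by (simp add: generic_def P coordinates_def)
qed

text \<open>
  Nonempty sums of terms (exponents, coefficient) without zero coefficients, such that the exponents on
  \<open>S\<close> alone distinguish the terms.  Exponents outside \<open>S\<close> are ignored by \<open>terms_value\<close>.  With this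
  convention, if \<open>S\<close> gains a variable, the terms that share its exponent again form such a sum
  on the old \<open>S\<close>, with the same exponent functions.
\<close>

definition separated_terms :: "'x set \<Rightarrow> (('x \<Rightarrow> nat) \<times> rat) set set" where
  "separated_terms S = {T. finite T \<and> T \<noteq> {} \<and> (\<forall>t\<in>T. snd t \<noteq> 0) \<and>
     (\<forall>t\<in>T. \<forall>t'\<in>T. (\<forall>c\<in>S. fst t c = fst t' c) \<longrightarrow> t = t')}"

definition terms_value :: "'x set \<Rightarrow> ('x \<Rightarrow> complex) \<Rightarrow> (('x \<Rightarrow> nat) \<times> rat) set \<Rightarrow> complex" where
  "terms_value S f T = (\<Sum>(m, a)\<in>T. of_rat a * (\<Prod>c\<in>S. f c ^ m c))"

lemma separated_termsI:
  assumes "finite T" "T \<noteq> {}" "\<And>t. t \<in> T \<Longrightarrow> snd t \<noteq> 0"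
    and "\<And>t t'. t \<in> T \<Longrightarrow> t' \<in> T \<Longrightarrow> \<forall>c\<in>S. fst t c = fst t' c \<Longrightarrow> t = t'"
  shows "T \<in> separated_terms S"
  using assms unfolding separated_terms_def by blast

lemma separated_termsD:
  assumes "T \<in> separated_terms S"
  shows "finite T" "T \<noteq> {}" "t \<in> T \<Longrightarrow> snd t \<noteq> 0"
    and "t \<in> T \<Longrightarrow> t' \<in> T \<Longrightarrow> \<forall>c\<in>S. fst t c = fst t' c \<Longrightarrow> t = t'"
  using assms unfolding separated_terms_def by blast+

lemma countable_separated_terms: "countable (separated_terms (S :: 'x::finite set))"
  by (rule countable_subset[OF _ countable_Collect_finite]) (auto dest: separated_termsD)

text \<open>
  Algebraically independent numbers are chosen one at a time.  When the values on \<open>S\<close> are fixed, each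
  nonzero polynomial in one more variable has a nonzero coefficient by the induction hypothesis, hence
  finitely many roots; there are countably many polynomials, so some complex number avoids all
  these roots.
\<close>

lemma exists_algebraically_independent_on:
  fixes S :: "'x::finite set"
  shows "\<exists>f. \<forall>T\<in>separated_terms S. terms_value S f T \<noteq> 0"
  using finite[of S]
proof (induction S rule: finite_induct)
  case empty
  have "terms_value {} f T \<noteq> 0" if T: "T \<in> separated_terms {}" for T :: "(('x \<Rightarrow> nat) \<times> rat) set" and f
  proof -
    obtain m a where ma: "(m, a) \<in> T" using separated_termsD(2)[OF T] by auto
    have "t = (m, a)" if "t \<in> T" for t
      using that ma by (intro separated_termsD(4)[OF T]) auto
    with ma have "T = {(m, a)}" by blast
    moreover have "a \<noteq> 0" using separated_termsD(3)[OF T ma] by simp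
    ultimately show ?thesis by (simp add: terms_value_def)
  qed
  then show ?case by blast
next
  case (insert c S)
  then obtain f where f: "\<And>T. T \<in> separated_terms S \<Longrightarrow> terms_value S f T \<noteq> 0" by blast
  define Q where "Q T = (\<Sum>(m, a)\<in>T. monom (of_rat a * (\<Prod>b\<in>S. f b ^ m b)) (m c))" for T
  have Q: "Q T \<noteq> 0" if T: "T \<in> separated_terms (insert c S)" for T
  proof -
    obtain m a where ma: "(m, a) \<in> T" using separated_termsD(2)[OF T] by auto
    define T' where "T' = {t\<in>T. fst t c = m c}"
    have "T' \<in> separated_terms S"
    proof (rule separated_termsI)
      show "finite T'" using separated_termsD(1)[OF T] by (simp add: T'_def)
      show "T' \<noteq> {}" using ma by (auto simp: T'_def)
      show "snd t \<noteq> 0" if "t \<in> T'" for t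
        using separated_termsD(3)[OF T] that by (simp add: T'_def)
      show "t = t'" if "t \<in> T'" "t' \<in> T'" "\<forall>b\<in>S. fst t b = fst t' b" for t t'
        using separated_termsD(4)[OF T, of t t'] that by (simp add: T'_def)
    qed
    moreover have "coeff (Q T) (m c) = terms_value S f T'"
    proof -
      have "coeff (Q T) (m c) = (\<Sum>(n, a)\<in>T. if n c = m c then of_rat a * (\<Prod>b\<in>S. f b ^ n b) else 0)"
        unfolding Q_def by (auto simp: coeff_sum intro!: sum.cong)
      also have "\<dots> = terms_value S f T'"
        using separated_termsD(1)[OF T] unfolding terms_value_def T'_def
        by (intro sum.mono_neutral_cong_right) (auto split: if_splits)
      finally show ?thesis .
    qed
    ultimately show ?thesis using f by fastforce
  qed
  have "countable (\<Union>T\<in>separated_terms (insert c S). {z. poly (Q T) z = 0})"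
    using Q by (intro countable_UN countable_separated_terms) (auto intro: countable_finite poly_roots_finite)
  then have "(\<Union>T\<in>separated_terms (insert c S). {z. poly (Q T) z = 0}) \<noteq> UNIV"
    using uncountable_UNIV_complex by metis
  then obtain z where z: "\<And>T. T \<in> separated_terms (insert c S) \<Longrightarrow> poly (Q T) z \<noteq> 0" by blast
  have "terms_value (insert c S) (f(c := z)) T = poly (Q T) z" for T
  proof -
    have "(\<Prod>b\<in>S. (f(c := z)) b ^ m b) = (\<Prod>b\<in>S. f b ^ m b)" for m :: "'x \<Rightarrow> nat"
      using insert.hyps by (intro prod.cong) auto
    then show ?thesis
      using insert.hyps by (auto simp: terms_value_def Q_def poly_sum poly_monom intro!: sum.cong)
  qed
  with z have "\<forall>T\<in>separated_terms (insert c S). terms_value (insert c S) (f(c := z)) T \<noteq> 0"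
    by metis
  then show ?case by blast
qed

lemma generic_exists: "\<exists>p :: ('v::finite, 'd::finite) realization. generic p"
proof -
  obtain f :: "'v \<times> 'd \<Rightarrow> complex" where f: "\<And>T. T \<in> separated_terms UNIV \<Longrightarrow> terms_value UNIV f T \<noteq> 0"
    using exists_algebraically_independent_on[of UNIV] by blast
  have "eval_poly P f \<noteq> 0" if "P \<noteq> 0" for P :: "('v \<times> 'd \<Rightarrow>\<^sub>0 nat) \<Rightarrow>\<^sub>0 rat"
  proof -
    define h where "h m = (Poly_Mapping.lookup m, Poly_Mapping.lookup P m)" for m
    have inj: "inj_on h A" for A
      by (rule inj_onI) (simp add: h_def)
    have "h ` Poly_Mapping.keys P \<in> separated_terms UNIV"
    proof (rule separated_termsI)
      show "finite (h ` Poly_Mapping.keys P)" "h ` Poly_Mapping.keys P \<noteq> {}" using that by auto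
      show "snd t \<noteq> 0" if "t \<in> h ` Poly_Mapping.keys P" for t
        using that by (auto simp: h_def in_keys_iff)
      show "t = t'" if t: "t \<in> h ` Poly_Mapping.keys P" "t' \<in> h ` Poly_Mapping.keys P"
          and eq: "\<forall>c\<in>UNIV. fst t c = fst t' c" for t t'
      proof -
        obtain m m' where m: "t = h m" "t' = h m'" using t by blast
        with eq have "Poly_Mapping.lookup m = Poly_Mapping.lookup m'"
          by (intro ext) (auto simp: h_def)
        then have "m = m'" by simp
        then show ?thesis using m by simp
      qed
    qed
    moreover have "terms_value UNIV f (h ` Poly_Mapping.keys P) = eval_poly P f"
      by (simp add: terms_value_def sum.reindex[OF inj] eval_poly_eq_sum[OF _ order_refl])
         (simp add: h_def monomial_value_def)
    ultimately show ?thesis using f by metis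
  qed
  then have "generic ((\<lambda>v. \<chi> i. f (v, i)) :: ('v, 'd) realization)"
    by (simp add: generic_def case_prod_beta')
  then show ?thesis by blast
qed

lemma generic_some_generic: "generic (some_generic :: ('v::finite, 'd::finite) realization)"
  unfolding some_generic_def by (rule someI_ex[OF generic_exists])

section \<open>Stresses and the rigidity matrix as bilinear forms on edges\<close>

text \<open>
  The product of the differences of \<open>q\<close> and \<open>r\<close> along the edge \<open>e\<close>.  Summing over ordered pairs
  makes it independent of an orientation of \<open>e\<close>, and the division by two compensates for the two orders.
\<close>

definition edge_form :: "'v set \<Rightarrow> ('v \<Rightarrow> complex) \<Rightarrow> ('v \<Rightarrow> complex) \<Rightarrow> complex" where
  "edge_form e q r = (\<Sum>x\<in>e. \<Sum>y\<in>e. (q x - q y) * (r x - r y)) / 2"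

abbreviation unit_at :: "'v \<Rightarrow> 'v \<Rightarrow> complex" where
  "unit_at w \<equiv> \<lambda>v. if v = w then 1 else 0"

lemma edge_form_pair:
  assumes "x \<noteq> y"
  shows "edge_form {x, y} q r = (q x - q y) * (r x - r y)"
proof -
  have "(q y - q x) * (r y - r x) = (q x - q y) * (r x - r y)" by (simp add: algebra_simps)
  then show ?thesis using assms by (simp add: edge_form_def)
qed

lemma edge_form_commute: "edge_form e q r = edge_form e r q"
  by (simp add: edge_form_def mult.commute)

lemma edge_form_zero: "edge_form e (\<lambda>v. 0) r = 0"
  by (simp add: edge_form_def)

lemma edge_form_add: "edge_form e (\<lambda>v. q v + q' v) r = edge_form e q r + edge_form e q' r"
  by (simp add: edge_form_def sum.distrib[symmetric] add_divide_distrib[symmetric] algebra_simps)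

lemma edge_form_scale: "edge_form e (\<lambda>v. c * q v) r = c * edge_form e q r"
  by (simp add: edge_form_def sum_distrib_left algebra_simps)

lemma edge_form_expand:
  fixes q r :: "'v::finite \<Rightarrow> complex"
  assumes "card e = 2"
  shows "edge_form e q r = (\<Sum>w\<in>UNIV. r w * edge_form e q (unit_at w))"
proof -
  obtain x y where e: "e = {x, y}" "x \<noteq> y" using assms by (auto simp: card_2_iff)
  have "(\<Sum>w\<in>UNIV. r w * edge_form e q (unit_at w)) = (q x - q y) *
      ((\<Sum>w\<in>UNIV. r w * (if x = w then 1 else 0)) - (\<Sum>w\<in>UNIV. r w * (if y = w then 1 else 0)))"
    using e(2) by (simp add: e(1) edge_form_pair sum_subtractf[symmetric] sum_distrib_left algebra_simps)
  also have "\<dots> = (q x - q y) * (r x - r y)"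
    by (simp add: if_distrib[of "\<lambda>z. _ * z"] sum.delta' cong: if_cong)
  finally show ?thesis using e(2) by (simp add: e(1) edge_form_pair)
qed

text \<open>
  Balance of forces at every vertex is the same as vanishing virtual work for every
  displacement.
\<close>

lemma edge_form_balance_iff:
  fixes q :: "'v::finite \<Rightarrow> complex"
  assumes "\<forall>e\<in>E. card e = 2"
  shows "(\<forall>w. (\<Sum>e\<in>E. c e * edge_form e q (unit_at w)) = 0) \<longleftrightarrow>
    (\<forall>r. (\<Sum>e\<in>E. c e * edge_form e q r) = 0)"
proof (intro iffI allI)
  fix r assume *: "\<forall>w. (\<Sum>e\<in>E. c e * edge_form e q (unit_at w)) = 0"
  have "(\<Sum>e\<in>E. c e * edge_form e q r) = (\<Sum>e\<in>E. \<Sum>w\<in>UNIV. r w * (c e * edge_form e q (unit_at w)))"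
    using assms by (intro sum.cong) (auto simp: edge_form_expand[of _ q r] sum_distrib_left mult_ac)
  also have "\<dots> = (\<Sum>w\<in>UNIV. r w * (\<Sum>e\<in>E. c e * edge_form e q (unit_at w)))"
    by (subst sum.swap) (simp add: sum_distrib_left)
  also have "\<dots> = 0" using * by simp
  finally show "(\<Sum>e\<in>E. c e * edge_form e q r) = 0" .
qed blast

text \<open>
  The row of the Jacobian, indexed by the edge as a set.  The factor 2 comes from differentiating
  a square.
\<close>

definition rigidity_row :: "('v::finite, 'd::finite) realization \<Rightarrow> 'v set \<Rightarrow> complex ^ ('v \<times> 'd)" where
  "rigidity_row p e = (\<chi> c. 2 * edge_form e (\<lambda>v. p v $ snd c) (unit_at (fst c)))"

lemma jacobian_row_eq:
  assumes "u \<noteq> v"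
  shows "jacobian_row p u v = rigidity_row p {u, v}"
  using assms by (auto simp: vec_eq_iff rigidity_row_def jacobian_row_nth edge_form_pair)

lemma jacobian_rank_eq:
  assumes "\<forall>e\<in>E. card e = 2"
  shows "jacobian_rank E p = vec.dim (rigidity_row p ` E)"
proof -
  have "{jacobian_row p u v |u v. {u, v} \<in> E} = rigidity_row p ` E"
  proof (intro equalityI subsetI)
    fix z assume "z \<in> {jacobian_row p u v |u v. {u, v} \<in> E}"
    then obtain u v where "z = jacobian_row p u v" "{u, v} \<in> E" by blast
    moreover from this assms have "u \<noteq> v" by fastforce
    ultimately show "z \<in> rigidity_row p ` E" by (simp add: jacobian_row_eq)
  next
    fix z assume "z \<in> rigidity_row p ` E"
    then obtain e where e: "e \<in> E" "z = rigidity_row p e" by blast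
    then obtain u v where "e = {u, v}" "u \<noteq> v" using assms by (metis card_2_iff)
    with e have "z = jacobian_row p u v \<and> {u, v} \<in> E"
      by (simp add: jacobian_row_eq)
    then show "z \<in> {jacobian_row p u v |u v. {u, v} \<in> E}" by blast
  qed
  then show ?thesis by (simp add: jacobian_rank_def)
qed

lemma rigidity_row_line:
  "rigidity_row (\<lambda>v. p v + t *s \<pi> v) e = rigidity_row p e + t *s rigidity_row \<pi> e"
  by (simp add: vec_eq_iff rigidity_row_def edge_form_add edge_form_scale algebra_simps)

lemma rigidity_row_pairing:
  assumes "card e = 2"
  shows "(\<Sum>c\<in>UNIV. rigidity_row p e $ c * \<mu> $ c) =
    2 * (\<Sum>i\<in>UNIV. edge_form e (\<lambda>v. p v $ i) (\<lambda>v. \<mu> $ (v, i)))"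
proof -
  have "(\<Sum>c\<in>UNIV. rigidity_row p e $ c * \<mu> $ c) =
      (\<Sum>w\<in>UNIV. \<Sum>i\<in>UNIV. rigidity_row p e $ (w, i) * \<mu> $ (w, i))"
    unfolding UNIV_Times_UNIV[symmetric] sum.cartesian_product by (simp add: case_prod_beta')
  also have "\<dots> = (\<Sum>i\<in>UNIV. \<Sum>w\<in>UNIV. 2 * (\<mu> $ (w, i) * edge_form e (\<lambda>v. p v $ i) (unit_at w)))"
    by (subst sum.swap) (simp add: rigidity_row_def mult_ac)
  also have "\<dots> = 2 * (\<Sum>i\<in>UNIV. edge_form e (\<lambda>v. p v $ i) (\<lambda>v. \<mu> $ (v, i)))"
    using edge_form_expand[OF assms, of "\<lambda>v. p v $ _" "\<lambda>v. \<mu> $ (v, _)"]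
    by (simp add: sum_distrib_left)
  finally show ?thesis .
qed

text \<open>
  The principle of virtual work for a one-dimensional realization \<open>q\<close>.  Stresses and the space
  \<open>K1\<close> are both described by it, coordinate by coordinate.
\<close>

definition equilibrium :: "'v set set \<Rightarrow> ('v set \<Rightarrow> complex) \<Rightarrow> ('v \<Rightarrow> complex) \<Rightarrow> bool" where
  "equilibrium E \<omega> q \<longleftrightarrow> (\<forall>r. (\<Sum>e\<in>E. \<omega> e * edge_form e q r) = 0)"

lemma rigidity_row_relation_iff:
  assumes "\<forall>e\<in>E. card e = 2"
  shows "(\<Sum>e\<in>E. \<omega> e *s rigidity_row p e) = 0 \<longleftrightarrow> (\<forall>i. equilibrium E \<omega> (\<lambda>v. p v $ i))"
proof -
  have "(\<Sum>e\<in>E. \<omega> e *s rigidity_row p e) = 0 \<longleftrightarrow>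
      (\<forall>c. (\<Sum>e\<in>E. \<omega> e * (2 * edge_form e (\<lambda>v. p v $ snd c) (unit_at (fst c)))) = 0)"
    by (simp add: vec_eq_iff rigidity_row_def)
  also have "\<dots> \<longleftrightarrow> (\<forall>c. (\<Sum>e\<in>E. \<omega> e * edge_form e (\<lambda>v. p v $ snd c) (unit_at (fst c))) = 0)"
    by (simp add: mult.left_commute[of _ 2] flip: sum_distrib_left)
  also have "\<dots> \<longleftrightarrow> (\<forall>i w. (\<Sum>e\<in>E. \<omega> e * edge_form e (\<lambda>v. p v $ i) (unit_at w)) = 0)"
    by auto
  finally show ?thesis
    unfolding equilibrium_def edge_form_balance_iff[OF assms] .
qed

lemma equilibrium_restrict:
  assumes "F \<subseteq> E" "\<And>e. e \<in> E - F \<Longrightarrow> \<omega> e = 0" "finite E"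
  shows "equilibrium E \<omega> q \<longleftrightarrow> equilibrium F \<omega> q"
proof -
  have "(\<Sum>e\<in>E. \<omega> e * edge_form e q r) = (\<Sum>e\<in>F. \<omega> e * edge_form e q r)" for r
    using assms by (intro sum.mono_neutral_right) auto
  then show ?thesis by (simp add: equilibrium_def)
qed

lemma stresses_iff:
  fixes E :: "'v::finite set set"
  assumes "\<forall>e\<in>E. card e = 2"
  shows "\<omega> \<in> stresses E p \<longleftrightarrow>
    (\<forall>e. e \<notin> E \<longrightarrow> \<omega> $ e = 0) \<and> (\<forall>i. equilibrium E (($) \<omega>) (\<lambda>v. p v $ i))"
proof -
  have force: "(\<Sum>e\<in>E. \<omega> $ e * edge_form e (\<lambda>v. p v $ i) (unit_at v)) =
      - (\<Sum>u | {u, v} \<in> E. \<omega> $ {u, v} *s (p u - p v)) $ i" for v i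
  proof -
    have ne: "u \<noteq> v" if "{u, v} \<in> E" for u using assms that by fastforce
    have "(\<Sum>e\<in>E. \<omega> $ e * edge_form e (\<lambda>v. p v $ i) (unit_at v)) =
        (\<Sum>e | e \<in> E \<and> v \<in> e. \<omega> $ e * edge_form e (\<lambda>v. p v $ i) (unit_at v))"
    proof (rule sum.mono_neutral_right)
      show "\<forall>e\<in>E - {e. e \<in> E \<and> v \<in> e}. \<omega> $ e * edge_form e (\<lambda>v. p v $ i) (unit_at v) = 0"
        by (auto simp: edge_form_def intro!: sum.neutral split: if_splits)
    qed auto
    also have "{e. e \<in> E \<and> v \<in> e} = (\<lambda>u. {u, v}) ` {u. {u, v} \<in> E}"
    proof (intro equalityI subsetI)
      fix e assume e: "e \<in> {e. e \<in> E \<and> v \<in> e}"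
      then obtain x y where "e = {x, y}" using assms by (metis (lifting) card_2_iff mem_Collect_eq)
      with e have "e = {x, v} \<or> e = {y, v}" by auto
      with e show "e \<in> (\<lambda>u. {u, v}) ` {u. {u, v} \<in> E}" by auto
    qed auto
    also have "(\<Sum>e\<in>(\<lambda>u. {u, v}) ` {u. {u, v} \<in> E}. \<omega> $ e * edge_form e (\<lambda>v. p v $ i) (unit_at v)) =
        (\<Sum>u | {u, v} \<in> E. \<omega> $ {u, v} * edge_form {u, v} (\<lambda>v. p v $ i) (unit_at v))"
      by (subst sum.reindex) (auto simp: inj_on_def doubleton_eq_iff)
    also have "\<dots> = (\<Sum>u | {u, v} \<in> E. - (\<omega> $ {u, v} * (p u $ i - p v $ i)))"
      by (intro sum.cong) (auto simp: edge_form_pair ne algebra_simps dest: ne)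
    finally show ?thesis
      unfolding sum_negf sum_component vector_smult_component vector_minus_component .
  qed
  have "(\<forall>v. (\<Sum>u | {u, v} \<in> E. \<omega> $ {u, v} *s (p u - p v)) = 0) \<longleftrightarrow>
      (\<forall>i w. (\<Sum>e\<in>E. \<omega> $ e * edge_form e (\<lambda>v. p v $ i) (unit_at w)) = 0)"
    unfolding force by (auto simp: vec_eq_iff)
  then show ?thesis
    by (simp add: stresses_def equilibrium_def edge_form_balance_iff[OF assms])
qed

lemma K1_iff:
  assumes "\<forall>e\<in>E. card e = 2"
  shows "q \<in> K1 E p \<longleftrightarrow> (\<forall>\<omega>\<in>stresses E p. equilibrium E (($) \<omega>) (($) q))"
proof -
  have "\<omega> \<in> stresses E (\<lambda>v. vec (q $ v) :: complex ^ 1) \<longleftrightarrow> equilibrium E (($) \<omega>) (($) q)"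
    if "\<omega> \<in> stresses E p" for \<omega>
    using that by (simp add: stresses_iff[OF assms])
  then show ?thesis unfolding K1_def by blast
qed

lemma subspace_K1:
  fixes E :: "'v::finite set set"
  assumes "\<forall>e\<in>E. card e = 2"
  shows "vec.subspace (K1 E p)"
  unfolding vec.subspace_def
proof (intro conjI ballI allI)
  show "0 \<in> K1 E p"
    unfolding K1_iff[OF assms] equilibrium_def by (simp add: edge_form_def)
  show "x + y \<in> K1 E p" if x: "x \<in> K1 E p" and y: "y \<in> K1 E p" for x y
    unfolding K1_iff[OF assms] equilibrium_def
  proof (intro ballI allI)
    fix \<omega> r assume \<omega>: "\<omega> \<in> stresses E p"
    have "edge_form e (($) (x + y)) r = edge_form e (($) x) r + edge_form e (($) y) r" for e
      using edge_form_add[of e "($) x" "($) y" r] by (simp add: edge_form_def)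
    then show "(\<Sum>e\<in>E. \<omega> $ e * edge_form e (($) (x + y)) r) = 0"
      using x y \<omega> by (simp add: K1_iff[OF assms] equilibrium_def distrib_left sum.distrib)
  qed
  show "c *s x \<in> K1 E p" if x: "x \<in> K1 E p" for c x
    unfolding K1_iff[OF assms] equilibrium_def
  proof (intro ballI allI)
    fix \<omega> r assume \<omega>: "\<omega> \<in> stresses E p"
    have "edge_form e (($) (c *s x)) r = c * edge_form e (($) x) r" for e
      using edge_form_scale[of e c "($) x" r] by (simp add: edge_form_def)
    then show "(\<Sum>e\<in>E. \<omega> $ e * edge_form e (($) (c *s x)) r) = 0"
      using x \<omega> by (simp add: K1_iff[OF assms] equilibrium_def mult.left_commute[of _ c]
          flip: sum_distrib_left)
  qed
qed

text \<open>
  A stress of the smaller graph is a stress of the larger one when it is extended by zero.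
\<close>

lemma K1_antimono:
  fixes E :: "'v::finite set set"
  assumes "\<forall>e\<in>E. card e = 2" "F \<subseteq> E"
  shows "K1 E p \<subseteq> K1 F p"
proof
  fix q assume q: "q \<in> K1 E p"
  have F: "\<forall>e\<in>F. card e = 2" using assms by blast
  show "q \<in> K1 F p"
    unfolding K1_iff[OF F]
  proof
    fix \<omega> assume "\<omega> \<in> stresses F p"
    then have 0: "\<And>e. e \<notin> F \<Longrightarrow> \<omega> $ e = 0" and eq: "\<And>i. equilibrium F (($) \<omega>) (\<lambda>v. p v $ i)"
      by (simp_all add: stresses_iff[OF F])
    have restrict: "equilibrium E (($) \<omega>) q' \<longleftrightarrow> equilibrium F (($) \<omega>) q'" for q'
      using assms(2) 0 by (intro equilibrium_restrict) auto
    have "\<omega> \<in> stresses E p"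
      using 0 eq assms(2) by (auto simp: stresses_iff[OF assms(1)] restrict)
    then show "equilibrium F (($) \<omega>) (($) q)"
      using q restrict unfolding K1_iff[OF assms(1)] by blast
  qed
qed

section \<open>Infinitesimal flexes at a generic realization\<close>

text \<open>
  A nonzero maximal minor at \<open>q\<close> is the value of a rational polynomial, which is then nonzero
  at \<open>p\<close>.
\<close>

lemma generic_rank_maximal:
  fixes p q :: "('v::finite, 'd::finite) realization"
  assumes "generic p" and F: "\<forall>e\<in>F. card e = 2"
  shows "vec.dim (rigidity_row q ` F) \<le> vec.dim (rigidity_row p ` F)"
proof -
  obtain C where C: "C \<subseteq> rigidity_row q ` F" "vec.independent C" "card C = vec.dim (rigidity_row q ` F)"
    by (rule vec.basis_exists[of "rigidity_row q ` F"])
  from C(1) have "\<forall>c\<in>C. \<exists>e\<in>F. rigidity_row q e = c" by auto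
  then obtain g where g: "g c \<in> F" "rigidity_row q (g c) = c" if "c \<in> C" for c by metis
  obtain \<beta> where \<beta>: "C \<subseteq> range \<beta>" "range \<beta> \<subseteq> C \<union> cart_basis" "det (\<chi> n. \<beta> n) \<noteq> 0"
    using C(2) by (rule basis_enumeration_extending)
  define row_of :: "('v \<times> 'd \<Rightarrow> complex) \<Rightarrow> 'v set \<Rightarrow> complex ^ ('v \<times> 'd)" where
    "row_of x e = (\<chi> c. 2 * edge_form e (\<lambda>v. x (v, snd c)) (unit_at (fst c)))" for x e
  have row_of: "row_of (coordinates p') e = rigidity_row p' e" for p' e
    by (simp add: row_of_def rigidity_row_def coordinates_def)
  define f where "f x = det (\<chi> n. if \<beta> n \<in> C then row_of x (g (\<beta> n)) else \<beta> n)" for x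
  have "rational_polynomial_function f"
    unfolding f_def
  proof (rule rational_polynomial_function_det)
    fix n k
    show "rational_polynomial_function
        (\<lambda>x. (\<chi> n. if \<beta> n \<in> C then row_of x (g (\<beta> n)) else \<beta> n) $ n $ k)"
    proof (cases "\<beta> n \<in> C")
      case True
      then obtain a b where "g (\<beta> n) = {a, b}" "a \<noteq> b"
        using F g(1)[OF True] by (metis card_2_iff)
      then have "(\<lambda>x. (\<chi> n. if \<beta> n \<in> C then row_of x (g (\<beta> n)) else \<beta> n) $ n $ k) =
          (\<lambda>x. of_int (2 * ((if a = fst k then 1 else 0) - (if b = fst k then 1 else 0))) *
             (x (a, snd k) - x (b, snd k)))"
        using True by (auto simp: row_of_def edge_form_pair fun_eq_iff)
      then show ?thesis
        by (simp only:) (intro rational_polynomial_function_mult rational_polynomial_function_of_int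
            rational_polynomial_function_diff rational_polynomial_function_coordinate)
    next
      case False
      then have "\<beta> n \<in> cart_basis" using \<beta>(2) by blast
      then obtain j where "\<beta> n = axis j 1" unfolding cart_basis_def by blast
      then have "(\<lambda>x. (\<chi> n. if \<beta> n \<in> C then row_of x (g (\<beta> n)) else \<beta> n) $ n $ k) =
          (\<lambda>x. of_int (if k = j then 1 else 0))"
        using False by (auto simp: axis_def)
      then show ?thesis by (simp only: rational_polynomial_function_of_int)
    qed
  qed
  moreover have "f (coordinates q) \<noteq> 0"
  proof -
    have "(if \<beta> n \<in> C then rigidity_row q (g (\<beta> n)) else \<beta> n) = \<beta> n" for n
      using g(2) by simp
    then show ?thesis using \<beta>(3) by (simp only: f_def row_of not_False_eq_True)
  qed
  ultimately have "f (coordinates p) \<noteq> 0" using assms(1) generic_nonzero by blast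
  moreover have "(\<lambda>c. rigidity_row p (g c)) ` C \<subseteq> vec.span (rigidity_row p ` F)"
    using g(1) by (auto intro: vec.span_base)
  ultimately have "card C \<le> vec.dim (rigidity_row p ` F)"
    using \<beta>(1) unfolding f_def row_of
    by (intro card_le_dim_of_perturbed_basis[of \<beta> C "\<lambda>c. rigidity_row p (g c)"])
  then show ?thesis using C(3) by simp
qed

text \<open>
  At a generic point every stress of the framework is also a stress of each of its infinitesimal
  flexes.  For a direction \<open>\<pi>\<close>, the derivative of the stress relation lies in the row space at \<open>p\<close>, so it
  annihilates the flex \<open>\<mu>\<close>; by symmetry of the edge form, its pairing with \<open>\<mu>\<close> is twice the virtual
  work of \<open>\<omega>\<close> at \<open>\<mu>\<close> along \<open>\<pi>\<close>.
\<close>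

lemma generic_stress_of_flex:
  fixes p \<mu> :: "('v::finite, 'd::finite) realization"
  assumes "generic p" and F: "\<forall>e\<in>F. card e = 2"
    and stress: "\<And>i. equilibrium F \<omega> (\<lambda>v. p v $ i)"
    and flex: "\<And>e. e \<in> F \<Longrightarrow> (\<Sum>i\<in>UNIV. edge_form e (\<lambda>v. p v $ i) (\<lambda>v. \<mu> v $ i)) = 0"
  shows "equilibrium F \<omega> (\<lambda>v. \<mu> v $ i)"
  unfolding equilibrium_def
proof
  fix r
  \<comment> \<open>Testing all directions that move only the coordinate \<open>i\<close> recovers the equilibrium of that coordinate.\<close>
  define \<pi> :: "('v, 'd) realization" where "\<pi> = (\<lambda>v. axis i (r v))"
  define m :: "complex ^ ('v \<times> 'd)" where "m = (\<chi> c. \<mu> (fst c) $ snd c)"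
  have row: "rigidity_row (\<lambda>v. p v + t *s \<pi> v) e = rigidity_row p e + t *s rigidity_row \<pi> e" for t e
    by (rule rigidity_row_line)
  have "(\<Sum>e\<in>F. \<omega> e *s rigidity_row \<pi> e) \<in> vec.span (rigidity_row p ` F)"
  proof (rule derivative_of_relation_in_span)
    show "vec.dim ((\<lambda>e. rigidity_row p e + t *s rigidity_row \<pi> e) ` F) \<le> vec.dim (rigidity_row p ` F)" for t
      unfolding row[symmetric] using assms(1) F by (rule generic_rank_maximal)
    show "(\<Sum>e\<in>F. \<omega> e *s rigidity_row p e) = 0"
      using stress by (simp add: rigidity_row_relation_iff[OF F])
  qed simp
  moreover have "vec.span (rigidity_row p ` F) \<subseteq> {s. (\<Sum>c\<in>UNIV. s $ c * m $ c) = 0}"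
  proof (rule vec.span_minimal)
    show "rigidity_row p ` F \<subseteq> {s. (\<Sum>c\<in>UNIV. s $ c * m $ c) = 0}"
      using F flex by (auto simp: rigidity_row_pairing) (simp add: m_def)
    show "vec.subspace {s. (\<Sum>c\<in>UNIV. s $ c * m $ c) = 0}"
      by (auto simp: vec.subspace_def sum.distrib distrib_right mult.assoc simp flip: sum_distrib_left)
  qed
  ultimately have "(\<Sum>c\<in>UNIV. (\<Sum>e\<in>F. \<omega> e *s rigidity_row \<pi> e) $ c * m $ c) = 0" by blast
  also have "(\<Sum>c\<in>UNIV. (\<Sum>e\<in>F. \<omega> e *s rigidity_row \<pi> e) $ c * m $ c) =
      (\<Sum>e\<in>F. \<omega> e * (\<Sum>c\<in>UNIV. rigidity_row \<pi> e $ c * m $ c))"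
    by (simp add: sum_distrib_right sum_distrib_left mult.assoc) (rule sum.swap)
  also have "\<dots> = (\<Sum>e\<in>F. \<omega> e * (2 * edge_form e (\<lambda>v. \<mu> v $ i) r))"
  proof (rule sum.cong[OF refl])
    fix e assume "e \<in> F"
    have "(\<Sum>j\<in>UNIV. edge_form e (\<lambda>v. \<pi> v $ j) (\<lambda>v. \<mu> v $ j)) =
        (\<Sum>j\<in>UNIV. if j = i then edge_form e r (\<lambda>v. \<mu> v $ j) else 0)"
      by (rule sum.cong) (auto simp: \<pi>_def axis_def edge_form_zero)
    then show "\<omega> e * (\<Sum>c\<in>UNIV. rigidity_row \<pi> e $ c * m $ c) = \<omega> e * (2 * edge_form e (\<lambda>v. \<mu> v $ i) r)"
      using F \<open>e \<in> F\<close> by (simp add: rigidity_row_pairing) (simp add: m_def edge_form_commute[of e r])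
  qed
  finally show "(\<Sum>e\<in>F. \<omega> e * edge_form e (\<lambda>v. \<mu> v $ i) r) = 0"
    by (simp add: mult.left_commute[of _ 2] flip: sum_distrib_left)
qed

section \<open>Projective invariance of stresses\<close>

text \<open>
  The infinitesimal form, edge by edge, of the projective invariance of stresses: the left side is
  the effect of changing the stress, the first sum on the right that of moving \<open>p\<close> in the direction
  \<open>- \<alpha> p\<close>.  The other two terms are the virtual work of \<open>p\<close> along the displacement \<open>\<alpha> \<mu>\<close>, and of
  \<open>\<alpha>\<close> along the displacement given by the scalar products of \<open>p\<close> and \<open>\<mu>\<close>.
\<close>

lemma projective_edge_identity:
  fixes p \<mu> :: "('v::finite, 'd::finite) realization"
  assumes "card e = 2"
  shows "(\<Sum>v\<in>e. \<alpha> v) * (\<Sum>i\<in>UNIV. edge_form e (\<lambda>v. p v $ i) (\<lambda>v. \<mu> v $ i)) =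
    (\<Sum>i\<in>UNIV. edge_form e (\<lambda>v. \<mu> v $ i) (\<lambda>v. \<alpha> v * p v $ i)) +
    (\<Sum>i\<in>UNIV. edge_form e (\<lambda>v. p v $ i) (\<lambda>v. \<alpha> v * \<mu> v $ i)) -
    edge_form e \<alpha> (\<lambda>v. \<Sum>i\<in>UNIV. p v $ i * \<mu> v $ i)"
proof -
  obtain x y where e: "e = {x, y}" "x \<noteq> y" using assms by (auto simp: card_2_iff)
  then show ?thesis
    by (simp add: edge_form_pair sum_distrib_left sum_subtractf[symmetric] sum.distrib[symmetric])
       (rule sum.cong[OF refl], simp add: algebra_simps)
qed

text \<open>
  Take the \<open>k\<close>-th coordinate of \<open>p\<close> for \<open>\<alpha>\<close> in the preceding identity and sum over the edges with
  the coefficients \<open>\<omega>\<close>.  Each term on the right becomes the virtual work of \<open>\<omega>\<close> at one coordinate of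
  \<open>p\<close> or \<open>\<mu>\<close>, which is zero.
\<close>

lemma projectively_weighted_stress:
  fixes p \<mu> :: "('v::finite, 'd::finite) realization"
  assumes E: "\<forall>e\<in>E. card e = 2"
    and p: "\<And>i. equilibrium E \<omega> (\<lambda>v. p v $ i)" and \<mu>: "\<And>i. equilibrium E \<omega> (\<lambda>v. \<mu> v $ i)"
  shows "(\<Sum>e\<in>E. \<omega> e * ((\<Sum>v\<in>e. p v $ k) *
    (\<Sum>i\<in>UNIV. edge_form e (\<lambda>v. p v $ i) (\<lambda>v. \<mu> v $ i)))) = 0"
proof -
  have swap: "(\<Sum>e\<in>E. \<omega> e * (\<Sum>i\<in>UNIV. f i e)) = (\<Sum>i\<in>UNIV. \<Sum>e\<in>E. \<omega> e * f i e)"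
    for f :: "'d \<Rightarrow> 'v set \<Rightarrow> complex"
    unfolding sum_distrib_left by (rule sum.swap)
  have "(\<Sum>e\<in>E. \<omega> e * ((\<Sum>v\<in>e. p v $ k) * (\<Sum>i\<in>UNIV. edge_form e (\<lambda>v. p v $ i) (\<lambda>v. \<mu> v $ i)))) =
      (\<Sum>e\<in>E. \<omega> e * (\<Sum>i\<in>UNIV. edge_form e (\<lambda>v. \<mu> v $ i) (\<lambda>v. p v $ k * p v $ i)) +
        \<omega> e * (\<Sum>i\<in>UNIV. edge_form e (\<lambda>v. p v $ i) (\<lambda>v. p v $ k * \<mu> v $ i)) -
        \<omega> e * edge_form e (\<lambda>v. p v $ k) (\<lambda>v. \<Sum>i\<in>UNIV. p v $ i * \<mu> v $ i))"
  proof (rule sum.cong[OF refl])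
    fix e assume "e \<in> E"
    with E have "card e = 2" by blast
    show "\<omega> e * ((\<Sum>v\<in>e. p v $ k) * (\<Sum>i\<in>UNIV. edge_form e (\<lambda>v. p v $ i) (\<lambda>v. \<mu> v $ i))) =
        \<omega> e * (\<Sum>i\<in>UNIV. edge_form e (\<lambda>v. \<mu> v $ i) (\<lambda>v. p v $ k * p v $ i)) +
        \<omega> e * (\<Sum>i\<in>UNIV. edge_form e (\<lambda>v. p v $ i) (\<lambda>v. p v $ k * \<mu> v $ i)) -
        \<omega> e * edge_form e (\<lambda>v. p v $ k) (\<lambda>v. \<Sum>i\<in>UNIV. p v $ i * \<mu> v $ i)"
      unfolding projective_edge_identity[OF \<open>card e = 2\<close>, of "\<lambda>v. p v $ k"]
      by (simp only: right_diff_distrib distrib_left)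
  qed
  also have "\<dots> = 0"
    using p \<mu> by (simp add: sum_subtractf sum.distrib swap equilibrium_def)
  finally show ?thesis .
qed

section \<open>Bridges\<close>

text \<open>
  A realization that puts one endpoint of \<open>e\<close> outside \<open>f\<close> at \<open>(1, \<dots>, 1)\<close> and everything else at the origin
  shows that the difference of the two sums is a nonzero polynomial.
\<close>

lemma generic_endpoint_sums_distinct:
  fixes p :: "('v::finite, 'd::finite) realization"
  assumes "generic p" "card e = 2" "card f = 2" "e \<noteq> f"
  shows "(\<Sum>v\<in>e. p v $ k) \<noteq> (\<Sum>v\<in>f. p v $ k)"
proof -
  have "\<not> e \<subseteq> f" using assms card_subset_eq[of f e] by auto
  then obtain w where w: "w \<in> e" "w \<notin> f" by blast
  define h :: "('v \<times> 'd \<Rightarrow> complex) \<Rightarrow> complex" where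
    "h x = (\<Sum>v\<in>e. x (v, k)) - (\<Sum>v\<in>f. x (v, k))" for x
  have "rational_polynomial_function h"
    unfolding h_def by (intro rational_polynomial_function_diff rational_polynomial_function_sum
        rational_polynomial_function_coordinate)
  moreover have "h (coordinates ((\<lambda>v. \<chi> i. unit_at w v) :: ('v, 'd) realization)) \<noteq> 0"
    using w by (simp add: h_def coordinates_def)
  ultimately have "h (coordinates p) \<noteq> 0" using assms(1) generic_nonzero by blast
  then show ?thesis by (simp add: h_def coordinates_def)
qed

lemma bridge_iff:
  fixes E :: "'v::finite set set"
  assumes "\<forall>e\<in>E. card e = 2"
  shows "bridge TYPE('d::finite) E e \<longleftrightarrow> e \<in> E \<and>
    rigidity_row (some_generic :: ('v, 'd) realization) e \<notin> vec.span (rigidity_row some_generic ` (E - {e}))"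
proof (cases "e \<in> E")
  case True
  let ?row = "rigidity_row (some_generic :: ('v, 'd) realization)"
  have "\<forall>f\<in>E - {e}. card f = 2" using assms by blast
  moreover have "?row ` E = insert (?row e) (?row ` (E - {e}))" using True by blast
  ultimately show ?thesis
    using True assms by (simp add: bridge_def rigidity_rank_def jacobian_rank_eq vec.dim_insert)
qed (simp add: bridge_def)

lemma linked_iff:
  fixes E :: "'v::finite set set"
  assumes "\<forall>e\<in>E. card e = 2" "u \<noteq> v"
  shows "linked TYPE('d::finite) E u v \<longleftrightarrow>
    rigidity_row (some_generic :: ('v, 'd) realization) {u, v} \<in> vec.span (rigidity_row some_generic ` E)"
proof -
  have "\<forall>f\<in>insert {u, v} E. card f = 2" using assms by simp
  then show ?thesis
    using assms by (simp add: linked_def rigidity_rank_def jacobian_rank_eq vec.dim_insert)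
qed

lemma stress_of_span:
  assumes "rigidity_row p e \<in> vec.span (rigidity_row p ` (E - {e}))" "e \<in> E" "\<forall>f\<in>E. card f = 2"
  obtains \<omega> where "\<omega> \<in> stresses E p" "\<omega> $ e \<noteq> 0"
proof -
  obtain c where c: "rigidity_row p e = (\<Sum>f\<in>E - {e}. c f *s rigidity_row p f)"
    using assms(1) by (rule span_image_coefficients) simp
  \<comment> \<open>Moving the row of \<open>e\<close> to the other side of \<open>c\<close> gives it the coefficient \<open>-1\<close>.\<close>
  define \<omega> where "\<omega> = (\<chi> f. if f = e then -1 else if f \<in> E then c f else 0)"
  have "(\<Sum>f\<in>E. \<omega> $ f *s rigidity_row p f) =
      \<omega> $ e *s rigidity_row p e + (\<Sum>f\<in>E - {e}. \<omega> $ f *s rigidity_row p f)"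
    using assms(2) by (intro sum.remove) auto
  also have "(\<Sum>f\<in>E - {e}. \<omega> $ f *s rigidity_row p f) = rigidity_row p e"
    unfolding c by (rule sum.cong) (auto simp: \<omega>_def)
  finally have "(\<Sum>f\<in>E. \<omega> $ f *s rigidity_row p f) = 0" by (simp add: \<omega>_def)
  then have "\<forall>i. equilibrium E (($) \<omega>) (\<lambda>v. p v $ i)"
    by (rule rigidity_row_relation_iff[OF assms(3), THEN iffD1])
  then have "\<omega> \<in> stresses E p"
    using assms(2) by (auto simp: stresses_iff[OF assms(3)] \<omega>_def)
  then show ?thesis by (rule that) (simp add: \<omega>_def)
qed

lemma stress_vanishes_at_bridge:
  assumes "rigidity_row p e \<notin> vec.span (rigidity_row p ` (E - {e}))" "e \<in> E" "\<forall>f\<in>E. card f = 2"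
    and "\<omega> \<in> stresses E p"
  shows "\<omega> $ e = 0"
proof (rule ccontr)
  assume ne: "\<omega> $ e \<noteq> 0"
  have "\<forall>i. equilibrium E (($) \<omega>) (\<lambda>v. p v $ i)"
    using assms(4) by (simp add: stresses_iff[OF assms(3)])
  then have "(\<Sum>f\<in>E. \<omega> $ f *s rigidity_row p f) = 0"
    by (rule rigidity_row_relation_iff[OF assms(3), THEN iffD2])
  also have "(\<Sum>f\<in>E. \<omega> $ f *s rigidity_row p f) =
      \<omega> $ e *s rigidity_row p e + (\<Sum>f\<in>E - {e}. \<omega> $ f *s rigidity_row p f)"
    using assms(2) by (intro sum.remove) auto
  finally have "\<omega> $ e *s rigidity_row p e = - (\<Sum>f\<in>E - {e}. \<omega> $ f *s rigidity_row p f)"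
    by (simp add: eq_neg_iff_add_eq_0)
  also have "\<dots> \<in> vec.span (rigidity_row p ` (E - {e}))"
    by (intro vec.span_neg vec.span_sum vec.span_scale vec.span_base imageI)
  finally have "(1 / \<omega> $ e) *s (\<omega> $ e *s rigidity_row p e) \<in> vec.span (rigidity_row p ` (E - {e}))"
    by (rule vec.span_scale)
  moreover have "(1 / \<omega> $ e) *s (\<omega> $ e *s rigidity_row p e) = rigidity_row p e"
    using ne by (simp add: vector_smult_assoc)
  ultimately show False using assms(1) by simp
qed

text \<open>
  A bridge can be lengthened at first order while all other edges keep their lengths.  All stresses
  of \<open>E\<close> vanish at the bridge, so they are stresses of \<open>E - {e}\<close>, for which the motion is a flex.
\<close>

lemma flex_at_bridge_in_K1:
  fixes p :: "('v::finite, 'd::finite) realization"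
  assumes "generic p" and bridge: "rigidity_row p e \<notin> vec.span (rigidity_row p ` (E - {e}))"
    and e: "e \<in> E" and E: "\<forall>f\<in>E. card f = 2"
  obtains \<mu> :: "('v, 'd) realization"
  where "\<And>i. (\<chi> v. \<mu> v $ i) \<in> K1 E p"
    and "\<And>f. f \<in> E - {e} \<Longrightarrow> (\<Sum>i\<in>UNIV. edge_form f (\<lambda>v. p v $ i) (\<lambda>v. \<mu> v $ i)) = 0"
    and "(\<Sum>i\<in>UNIV. edge_form e (\<lambda>v. p v $ i) (\<lambda>v. \<mu> v $ i)) \<noteq> 0"
proof -
  obtain m where m: "\<And>s. s \<in> rigidity_row p ` (E - {e}) \<Longrightarrow> (\<Sum>c\<in>UNIV. s $ c * m $ c) = 0"
      "(\<Sum>c\<in>UNIV. rigidity_row p e $ c * m $ c) = 1"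
    using separating_vector[OF bridge] by metis
  define \<mu> :: "('v, 'd) realization" where "\<mu> = (\<lambda>v. \<chi> i. m $ (v, i))"
  have pairing: "(\<Sum>c\<in>UNIV. rigidity_row p f $ c * m $ c) =
      2 * (\<Sum>i\<in>UNIV. edge_form f (\<lambda>v. p v $ i) (\<lambda>v. \<mu> v $ i))" if "f \<in> E" for f
    using E that by (simp add: rigidity_row_pairing \<mu>_def)
  have flex: "(\<Sum>i\<in>UNIV. edge_form f (\<lambda>v. p v $ i) (\<lambda>v. \<mu> v $ i)) = 0" if "f \<in> E - {e}" for f
    using m(1)[of "rigidity_row p f"] that pairing[of f] by auto
  have "(\<Sum>i\<in>UNIV. edge_form e (\<lambda>v. p v $ i) (\<lambda>v. \<mu> v $ i)) \<noteq> 0"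
    using m(2) pairing[OF e] by auto
  moreover have "(\<chi> v. \<mu> v $ i) \<in> K1 E p" for i
    unfolding K1_iff[OF E]
  proof
    fix \<omega> assume \<omega>: "\<omega> \<in> stresses E p"
    have restrict: "equilibrium E (($) \<omega>) q \<longleftrightarrow> equilibrium (E - {e}) (($) \<omega>) q" for q
      using stress_vanishes_at_bridge[OF bridge e E \<omega>] by (intro equilibrium_restrict) auto
    have "equilibrium (E - {e}) (($) \<omega>) (\<lambda>v. \<mu> v $ i)"
    proof (rule generic_stress_of_flex[OF assms(1)])
      show "\<forall>f\<in>E - {e}. card f = 2" using E by blast
      show "equilibrium (E - {e}) (($) \<omega>) (\<lambda>v. p v $ j)" for j
        using \<omega> unfolding restrict[symmetric] by (simp add: stresses_iff[OF E])
    qed (rule flex)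
    moreover have "(\<lambda>v. (\<chi> v. \<mu> v $ i) $ v) = (\<lambda>v. \<mu> v $ i)" by simp
    ultimately show "equilibrium E (($) \<omega>) (($) (\<chi> v. \<mu> v $ i))"
      by (simp only: restrict)
  qed
  ultimately show ?thesis using flex that by blast
qed

text \<open>
  If \<open>e\<close> were no longer a bridge, some stress \<open>\<omega>\<close> of the larger graph would be nonzero at \<open>e\<close>.  Both
  \<open>\<omega>\<close> and its projectively weighted form annihilate the first-order length changes of a flex \<open>\<mu>\<close> of
  \<open>E - {e}\<close>, which vanish except at \<open>e\<close> and \<open>g\<close>; comparing the two equations forces equal
  sums of coordinates at the ends of \<open>e\<close> and \<open>g\<close>.
\<close>

lemma bridge_persists:
  fixes p :: "('v::finite, 'd::finite) realization"
  assumes p: "generic p" and E: "\<forall>f\<in>E. card f = 2" and g: "card g = 2" "g \<notin> E"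
    and K1: "K1 (insert g E) p = K1 E p"
    and e: "e \<in> E" and bridge: "rigidity_row p e \<notin> vec.span (rigidity_row p ` (E - {e}))"
  shows "rigidity_row p e \<notin> vec.span (rigidity_row p ` (insert g E - {e}))"
proof
  assume span: "rigidity_row p e \<in> vec.span (rigidity_row p ` (insert g E - {e}))"
  let ?E = "insert g E"
  have E': "\<forall>f\<in>?E. card f = 2" using E g by simp
  obtain \<omega> where \<omega>: "\<omega> \<in> stresses ?E p" "\<omega> $ e \<noteq> 0"
    by (rule stress_of_span[OF span _ E']) (use e in auto)
  obtain \<mu> :: "('v, 'd) realization" where \<mu>: "\<And>i. (\<chi> v. \<mu> v $ i) \<in> K1 E p"
    and flex: "\<And>f. f \<in> E - {e} \<Longrightarrow> (\<Sum>i\<in>UNIV. edge_form f (\<lambda>v. p v $ i) (\<lambda>v. \<mu> v $ i)) = 0"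
    and ne: "(\<Sum>i\<in>UNIV. edge_form e (\<lambda>v. p v $ i) (\<lambda>v. \<mu> v $ i)) \<noteq> 0"
    by (rule flex_at_bridge_in_K1[OF p bridge e E]) (rule that)
  define s where "s f = (\<Sum>i\<in>UNIV. edge_form f (\<lambda>v. p v $ i) (\<lambda>v. \<mu> v $ i))" for f
  have eq_p: "equilibrium ?E (($) \<omega>) (\<lambda>v. p v $ i)" for i
    using \<omega>(1) by (simp add: stresses_iff[OF E'])
  have eq_\<mu>: "equilibrium ?E (($) \<omega>) (\<lambda>v. \<mu> v $ i)" for i
  proof -
    have "(\<chi> v. \<mu> v $ i) \<in> K1 ?E p" using \<mu> K1 by simp
    then have "equilibrium ?E (($) \<omega>) (($) (\<chi> v. \<mu> v $ i))"
      using \<omega>(1) unfolding K1_iff[OF E'] by blast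
    moreover have "(\<lambda>v. (\<chi> v. \<mu> v $ i) $ v) = (\<lambda>v. \<mu> v $ i)" by simp
    ultimately show ?thesis by (simp only:)
  qed
  have only_two: "(\<Sum>f\<in>?E. \<omega> $ f * (a f * s f)) = \<omega> $ e * (a e * s e) + \<omega> $ g * (a g * s g)" for a
  proof -
    have "(\<Sum>f\<in>?E. \<omega> $ f * (a f * s f)) = (\<Sum>f\<in>{e, g}. \<omega> $ f * (a f * s f))"
      using e flex by (intro sum.mono_neutral_right) (auto simp: s_def)
    moreover have "e \<noteq> g" using e g(2) by blast
    ultimately show ?thesis by simp
  qed
  \<comment> \<open>Any coordinate serves as the linear functional \<open>\<alpha>\<close>.\<close>
  fix k :: 'd
  define a where "a f = (\<Sum>v\<in>f. p v $ k)" for f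
  have "(\<Sum>f\<in>?E. \<omega> $ f * (1 * s f)) = (\<Sum>i\<in>UNIV. \<Sum>f\<in>?E. \<omega> $ f * edge_form f (\<lambda>v. p v $ i) (\<lambda>v. \<mu> v $ i))"
    unfolding s_def mult_1 sum_distrib_left by (rule sum.swap)
  also have "\<dots> = 0" using eq_p by (simp add: equilibrium_def)
  finally have 1: "\<omega> $ e * s e + \<omega> $ g * s g = 0"
    unfolding only_two by simp
  have "(\<Sum>f\<in>?E. \<omega> $ f * (a f * s f)) = 0"
    unfolding a_def s_def using E' eq_p eq_\<mu> by (rule projectively_weighted_stress)
  then have 2: "\<omega> $ e * (a e * s e) + \<omega> $ g * (a g * s g) = 0"
    unfolding only_two .
  have "\<omega> $ e * s e * (a e - a g) =
      (\<omega> $ e * (a e * s e) + \<omega> $ g * (a g * s g)) - a g * (\<omega> $ e * s e + \<omega> $ g * s g)"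
    by (simp add: algebra_simps)
  then have "\<omega> $ e * s e * (a e - a g) = 0" using 1 2 by simp
  moreover have "a e \<noteq> a g"
    unfolding a_def using p E e g by (intro generic_endpoint_sums_distinct) auto
  ultimately show False using \<omega>(2) ne by (simp add: s_def)
qed

theorem theorem4p7:
  fixes E :: "'v::finite set set" and u v :: 'v
  assumes "graph E"
    and "u \<noteq> v"
    and "stress_linked TYPE('d::finite) E u v"
  shows "{e. bridge TYPE('d) E e} = {e. bridge TYPE('d) (insert {u, v} E) e}"
proof (cases "{u, v} \<in> E")
  case True
  then show ?thesis by (simp add: insert_absorb)
next
  case False
  let ?E = "insert {u, v} E" and ?p = "some_generic :: ('v, 'd) realization"
  have E: "\<forall>e\<in>E. card e = 2" using assms(1) by (simp add: graph_def)
  then have E': "\<forall>e\<in>?E. card e = 2" using assms(2) by simp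
  have linked: "rigidity_row ?p {u, v} \<in> vec.span (rigidity_row ?p ` E)"
    using assms(3) linked_iff[OF E assms(2), where ?'d = 'd] by (simp add: stress_linked_def)
  have "vec.dim (K1 ?E ?p) = vec.dim (K1 E ?p)"
    using assms(3) by (simp add: stress_linked_def k_dim_def)
  then have K1: "K1 ?E ?p = K1 E ?p"
    using subspace_K1[OF E] subspace_K1[OF E'] K1_antimono[OF E', of E]
    by (intro vec.subspace_dim_equal) auto
  have "bridge TYPE('d) E e \<longleftrightarrow> bridge TYPE('d) ?E e" for e
  proof
    assume "bridge TYPE('d) E e"
    then show "bridge TYPE('d) ?E e"
      unfolding bridge_iff[OF E] bridge_iff[OF E']
      using bridge_persists[OF generic_some_generic E _ False K1] assms(2) by auto
  next
    assume "bridge TYPE('d) ?E e"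
    then have e: "e \<in> ?E" "rigidity_row ?p e \<notin> vec.span (rigidity_row ?p ` (?E - {e}))"
      unfolding bridge_iff[OF E'] by auto
    have "e \<noteq> {u, v}" using e(2) linked False by auto
    moreover have "vec.span (rigidity_row ?p ` (E - {e})) \<subseteq> vec.span (rigidity_row ?p ` (?E - {e}))"
      by (intro vec.span_mono) auto
    ultimately show "bridge TYPE('d) E e"
      unfolding bridge_iff[OF E] using e by auto
  qed
  then show ?thesis by simp
qed

end
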